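(* Let $C_0,C$ be constants and let $\lambda^2(\rho)=\rho^2+2C_0\rho+C>0$. Then the map $\varphi:(S^2,dr^2+\sin^2r\,d\theta^2)\to(N^2,d\rho^2+\lambda^2(\rho)d\phi^2)$ with $\varphi(r,\theta)=(\rho(r),\theta)$ is biharmonic if and only if $$\begin{aligned}\rho(r)={}&(C_1-C_2+C_3)\left|\cot\tfrac r2\right|+\left(2C_1\ln\left|\tan\tfrac r2\right|+C_4\right)\left|\tan\tfrac r2\right|\\&-\left(C_1\left|\tan\tfrac r2\right|+C_2\left|\cot\tfrac r2\right|\right)\ln\left(1+\tan^2\tfrac r2\right)-C_0\end{aligned}$$ for some constants $C_1,C_2,C_3,C_4$. Furthermore, when $C_1^2+C_2^2\neq0$, the rotationally symmetric maps determined by this formula are proper biharmonic maps.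
   Context: All objects are smooth. $(r,\theta)$ are geodesic polar coordinates on the unit 2-sphere, with $r$ in an open interval $I\subseteq(0,\pi)$ on which the map is defined. $N^2$ is a surface with coordinates $(\rho,\phi)$, $\rho$ in an open interval $J$ on which $\lambda^2(\rho)>0$, and metric $d\rho^2+\lambda^2(\rho)d\phi^2$. Maps are given by their expressions in these coordinates, with $\rho:I\to J$, and biharmonicity is considered on the coordinate domain (maps need only be locally defined on $S^2$). The tension field of a map $\varphi:(M,g)\to(N,h)$ is $\tau(\varphi)=\mathrm{Tr}_g\nabla d\varphi$; $\varphi$ is harmonic if $\tau(\varphi)=0$, and biharmonic if $\tau_2(\varphi)=\mathrm{Tr}_g(\nabla^\varphi\nabla^\varphi-\nabla^\varphi_{\nabla^M})\tau(\varphi)-\mathrm{Tr}_gR^N(d\varphi,\tau(\varphi))d\varphi=0$, where $R^N(X,Y)Z=[\nabla^N_X,\nabla^N_Y]Z-\nabla^N_{[X,Y]}Z$. A proper biharmonic map is a biharmonic map that is not harmonic. *)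

theory Defs
  imports "HOL-Analysis.Analysis"
begin

text \<open>
  Riemannian geometry in a single coordinate chart.  A point is its coordinate vector in
  \<^typ>\<open>real ^ 'm\<close>, a vector field (or a section along a map) is its vector of components, and a
  metric \<open>g\<close> assigns to each point the Gram matrix of the coordinate frame.
\<close>

primrec higher_differentiable_on ::
  "'a::real_normed_vector set \<Rightarrow> ('a \<Rightarrow> 'b::real_normed_vector) \<Rightarrow> nat \<Rightarrow> bool" where
  "higher_differentiable_on S f 0 \<longleftrightarrow> continuous_on S f"
| "higher_differentiable_on S f (Suc n) \<longleftrightarrow>
     (\<forall>x\<in>S. f differentiable (at x)) \<and>
     (\<forall>v. higher_differentiable_on S (\<lambda>x. frechet_derivative f (at x) v) n)"

text \<open>\<open>C\<^sup>\<infinity>\<close> on an open set \<open>S\<close>.\<close>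

definition smooth_on :: "'a::real_normed_vector set \<Rightarrow> ('a \<Rightarrow> 'b::real_normed_vector) \<Rightarrow> bool" where
  "smooth_on S f \<longleftrightarrow> (\<forall>n. higher_differentiable_on S f n)"

definition frame :: "'m::finite \<Rightarrow> real ^ 'm \<Rightarrow> real ^ 'm" where
  "frame i = (\<lambda>x. axis i 1)"

definition partial :: "'m::finite \<Rightarrow> (real ^ 'm \<Rightarrow> real) \<Rightarrow> real ^ 'm \<Rightarrow> real" where
  "partial i f x = frechet_derivative f (at x) (axis i 1)"

text \<open>\<open>christoffel g k i j\<close> has upper index \<open>k\<close> and lower indices \<open>i j\<close>.\<close>

definition christoffel ::
  "(real ^ 'm \<Rightarrow> real ^ 'm ^ 'm) \<Rightarrow> 'm::finite \<Rightarrow> 'm \<Rightarrow> 'm \<Rightarrow> real ^ 'm \<Rightarrow> real" where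
  "christoffel g k i j x =
     (1/2) * (\<Sum>l\<in>UNIV. matrix_inv (g x) $ k $ l *
        (partial i (\<lambda>y. g y $ j $ l) x + partial j (\<lambda>y. g y $ i $ l) x
          - partial l (\<lambda>y. g y $ i $ j) x))"

definition christoffel_form ::
  "(real ^ 'm \<Rightarrow> real ^ 'm ^ 'm) \<Rightarrow> real ^ 'm \<Rightarrow> real ^ 'm \<Rightarrow> real ^ 'm \<Rightarrow> real ^ 'm::finite" where
  "christoffel_form g x u v =
     (\<chi> k. \<Sum>i\<in>UNIV. \<Sum>j\<in>UNIV. christoffel g k i j x * u $ i * v $ j)"

text \<open>The Levi-Civita connection \<open>\<nabla>\<^sub>X Y\<close>.\<close>

definition levi_civita ::
  "(real ^ 'm \<Rightarrow> real ^ 'm ^ 'm) \<Rightarrow> (real ^ 'm \<Rightarrow> real ^ 'm) \<Rightarrow> (real ^ 'm \<Rightarrow> real ^ 'm)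
     \<Rightarrow> real ^ 'm \<Rightarrow> real ^ 'm::finite" where
  "levi_civita g X Y x =
     frechet_derivative Y (at x) (X x) + christoffel_form g x (X x) (Y x)"

definition lie_bracket ::
  "(real ^ 'm \<Rightarrow> real ^ 'm) \<Rightarrow> (real ^ 'm \<Rightarrow> real ^ 'm) \<Rightarrow> real ^ 'm \<Rightarrow> real ^ 'm::finite" where
  "lie_bracket X Y x = frechet_derivative Y (at x) (X x) - frechet_derivative X (at x) (Y x)"

definition curvature ::
  "(real ^ 'm \<Rightarrow> real ^ 'm ^ 'm) \<Rightarrow> (real ^ 'm \<Rightarrow> real ^ 'm) \<Rightarrow> (real ^ 'm \<Rightarrow> real ^ 'm)
     \<Rightarrow> (real ^ 'm \<Rightarrow> real ^ 'm) \<Rightarrow> real ^ 'm \<Rightarrow> real ^ 'm::finite" where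
  "curvature g X Y Z x =
     levi_civita g X (levi_civita g Y Z) x - levi_civita g Y (levi_civita g X Z) x
       - levi_civita g (lie_bracket X Y) Z x"

text \<open>
  \<open>R(u, v) w\<close> for tangent vectors at \<open>p\<close>.  As the curvature is tensorial, the vectors may be
  extended to arbitrary fields; the extension chosen here has constant components.
\<close>

definition curvature_at ::
  "(real ^ 'm \<Rightarrow> real ^ 'm ^ 'm) \<Rightarrow> real ^ 'm \<Rightarrow> real ^ 'm \<Rightarrow> real ^ 'm \<Rightarrow> real ^ 'm
     \<Rightarrow> real ^ 'm::finite" where
  "curvature_at g p u v w = curvature g (\<lambda>_. u) (\<lambda>_. v) (\<lambda>_. w) p"

definition differential ::
  "(real ^ 'm \<Rightarrow> real ^ 'n) \<Rightarrow> (real ^ 'm \<Rightarrow> real ^ 'm) \<Rightarrow> real ^ 'm::finite \<Rightarrow> real ^ 'n::finite" where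
  "differential \<phi> X x = frechet_derivative \<phi> (at x) (X x)"

text \<open>
  The pull-back connection \<open>\<nabla>\<^sup>\<phi>\<^sub>X V\<close> for a vector field \<open>X\<close> on the domain and a section \<open>V\<close> along
  \<open>\<phi>\<close>; \<open>h\<close> is the target metric.
\<close>

definition pullback_connection ::
  "(real ^ 'n \<Rightarrow> real ^ 'n ^ 'n) \<Rightarrow> (real ^ 'm \<Rightarrow> real ^ 'n) \<Rightarrow> (real ^ 'm \<Rightarrow> real ^ 'm)
     \<Rightarrow> (real ^ 'm \<Rightarrow> real ^ 'n) \<Rightarrow> real ^ 'm::finite \<Rightarrow> real ^ 'n::finite" where
  "pullback_connection h \<phi> X V x =
     frechet_derivative V (at x) (X x) + christoffel_form h (\<phi> x) (differential \<phi> X x) (V x)"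

text \<open>The trace of a bilinear form on vector fields with values in sections along a map.\<close>

definition metric_trace ::
  "(real ^ 'm \<Rightarrow> real ^ 'm ^ 'm)
     \<Rightarrow> ((real ^ 'm \<Rightarrow> real ^ 'm) \<Rightarrow> (real ^ 'm \<Rightarrow> real ^ 'm) \<Rightarrow> real ^ 'm \<Rightarrow> real ^ 'n)
     \<Rightarrow> real ^ 'm::finite \<Rightarrow> real ^ 'n::finite" where
  "metric_trace g B x =
     (\<Sum>i\<in>UNIV. \<Sum>j\<in>UNIV. (matrix_inv (g x) $ i $ j) *\<^sub>R B (frame i) (frame j) x)"

definition tension_field ::
  "(real ^ 'm \<Rightarrow> real ^ 'm ^ 'm) \<Rightarrow> (real ^ 'n \<Rightarrow> real ^ 'n ^ 'n) \<Rightarrow> (real ^ 'm \<Rightarrow> real ^ 'n)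
     \<Rightarrow> real ^ 'm::finite \<Rightarrow> real ^ 'n::finite" where
  "tension_field g h \<phi> =
     metric_trace g (\<lambda>X Y x. pullback_connection h \<phi> X (differential \<phi> Y) x
                             - differential \<phi> (levi_civita g X Y) x)"

definition bitension_field ::
  "(real ^ 'm \<Rightarrow> real ^ 'm ^ 'm) \<Rightarrow> (real ^ 'n \<Rightarrow> real ^ 'n ^ 'n) \<Rightarrow> (real ^ 'm \<Rightarrow> real ^ 'n)
     \<Rightarrow> real ^ 'm::finite \<Rightarrow> real ^ 'n::finite" where
  "bitension_field g h \<phi> x =
     metric_trace g (\<lambda>X Y x.
        pullback_connection h \<phi> X (pullback_connection h \<phi> Y (tension_field g h \<phi>)) x
          - pullback_connection h \<phi> (levi_civita g X Y) (tension_field g h \<phi>) x) x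
     - metric_trace g (\<lambda>X Y x.
        curvature_at h (\<phi> x) (differential \<phi> X x) (tension_field g h \<phi> x) (differential \<phi> Y x)) x"

definition harmonic_map ::
  "(real ^ 'm) set \<Rightarrow> (real ^ 'm \<Rightarrow> real ^ 'm ^ 'm) \<Rightarrow> (real ^ 'n \<Rightarrow> real ^ 'n ^ 'n)
     \<Rightarrow> (real ^ 'm::finite \<Rightarrow> real ^ 'n::finite) \<Rightarrow> bool" where
  "harmonic_map U g h \<phi> \<longleftrightarrow> smooth_on U \<phi> \<and> (\<forall>x\<in>U. tension_field g h \<phi> x = 0)"

definition biharmonic_map ::
  "(real ^ 'm) set \<Rightarrow> (real ^ 'm \<Rightarrow> real ^ 'm ^ 'm) \<Rightarrow> (real ^ 'n \<Rightarrow> real ^ 'n ^ 'n)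
     \<Rightarrow> (real ^ 'm::finite \<Rightarrow> real ^ 'n::finite) \<Rightarrow> bool" where
  "biharmonic_map U g h \<phi> \<longleftrightarrow> smooth_on U \<phi> \<and> (\<forall>x\<in>U. bitension_field g h \<phi> x = 0)"

definition proper_biharmonic_map ::
  "(real ^ 'm) set \<Rightarrow> (real ^ 'm \<Rightarrow> real ^ 'm ^ 'm) \<Rightarrow> (real ^ 'n \<Rightarrow> real ^ 'n ^ 'n)
     \<Rightarrow> (real ^ 'm::finite \<Rightarrow> real ^ 'n::finite) \<Rightarrow> bool" where
  "proper_biharmonic_map U g h \<phi> \<longleftrightarrow> biharmonic_map U g h \<phi> \<and> \<not> harmonic_map U g h \<phi>"

text \<open>The metric \<open>ds\<^sup>2 + w(s) d\<alpha>\<^sup>2\<close> in coordinates \<open>(s, \<alpha>)\<close>; \<open>w\<close> is the square of the warping function.\<close>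

definition rotational_metric :: "(real \<Rightarrow> real) \<Rightarrow> real ^ 2 \<Rightarrow> real ^ 2 ^ 2" where
  "rotational_metric w x = vector [vector [1, 0], vector [0, w (x $ 1)]]"

definition sphere_metric :: "real ^ 2 \<Rightarrow> real ^ 2 ^ 2" where
  "sphere_metric = rotational_metric (\<lambda>r. (sin r)\<^sup>2)"

definition lambda_sq :: "real \<Rightarrow> real \<Rightarrow> real \<Rightarrow> real" where
  "lambda_sq C\<^sub>0 C \<rho> = \<rho>\<^sup>2 + 2 * C\<^sub>0 * \<rho> + C"

definition target_metric :: "real \<Rightarrow> real \<Rightarrow> real ^ 2 \<Rightarrow> real ^ 2 ^ 2" where
  "target_metric C\<^sub>0 C = rotational_metric (lambda_sq C\<^sub>0 C)"

text \<open>
  The angular coordinate is a real number (lifted from the circle), so no cut of the circle has to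
  be chosen; all expressions below are local and do not depend on the angle.
\<close>

definition polar_domain :: "real set \<Rightarrow> (real ^ 2) set" where
  "polar_domain I = {x. x $ 1 \<in> I}"

text \<open>The coordinate expression \<open>(r, \<theta>) \<mapsto> (\<rho>(r), \<theta>)\<close>.\<close>

definition rot_map :: "(real \<Rightarrow> real) \<Rightarrow> real ^ 2 \<Rightarrow> real ^ 2" where
  "rot_map \<rho> x = vector [\<rho> (x $ 1), x $ 2]"

definition rho_family :: "real \<Rightarrow> real \<Rightarrow> real \<Rightarrow> real \<Rightarrow> real \<Rightarrow> real \<Rightarrow> real" where
  "rho_family C\<^sub>0 C\<^sub>1 C\<^sub>2 C\<^sub>3 C\<^sub>4 r =
     (C\<^sub>1 - C\<^sub>2 + C\<^sub>3) * \<bar>cot (r/2)\<bar> + (2 * C\<^sub>1 * ln \<bar>tan (r/2)\<bar> + C\<^sub>4) * \<bar>tan (r/2)\<bar>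
     - (C\<^sub>1 * \<bar>tan (r/2)\<bar> + C\<^sub>2 * \<bar>cot (r/2)\<bar>) * ln (1 + (tan (r/2))\<^sup>2) - C\<^sub>0"

end

theory Submission
  imports Defs
begin

text \<open>
  For the target metric \<open>d\<rho>\<^sup>2 + w(\<rho>) d\<phi>\<^sup>2\<close> the map \<open>(r, \<theta>) \<mapsto> (\<rho>(r), \<theta>)\<close> from the sphere has
  tension field \<open>(F, 0)\<close> with \<open>F = \<rho>'' + cot r \<rho>' - w'(\<rho>) / (2 sin\<^sup>2 r)\<close>, and its bitension field is
  \<open>(F'' + cot r F' - w''(\<rho>) F / (2 sin\<^sup>2 r), 0)\<close>: the connection contributes the square of
  \<open>w' / (2 \<surd>w)\<close>, and the curvature term turns it into \<open>w'' / 2\<close>.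
  The point of the choice \<open>w = \<rho>\<^sup>2 + 2 C\<^sub>0 \<rho> + C\<close> is that \<open>w'' = 2\<close> is constant and
  \<open>w' / 2 = \<rho> + C\<^sub>0\<close>.  With \<open>u = \<rho> + C\<^sub>0\<close> and the linear operator
  \<open>L y = y'' + cot r y' - y / sin\<^sup>2 r\<close> one gets \<open>F = L u\<close>, and the map is biharmonic iff
  \<open>L (L u) = 0\<close>.  The lemmas on \<open>tension_field\<close> and \<open>bitension_field\<close> in the locale
  \<open>rotational_map\<close> treat an arbitrary \<open>w\<close>; \<open>sphere_rot_map_fields\<close> specialises them.

  In the variable \<open>t = ln (tan (r/2))\<close> one has \<open>sin\<^sup>2 r L = d\<^sup>2/dt\<^sup>2 - 1\<close>, so that the kernel of \<open>L\<close> is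
  spanned by \<open>tan (r/2)\<close> and \<open>cot (r/2)\<close> (\<open>radial_op_kernel\<close>).  The stated family satisfies
  \<open>L (\<rho> + C\<^sub>0) = C\<^sub>1 cot (r/2) + C\<^sub>2 tan (r/2)\<close> (\<open>rho_family_derivs\<close>): it contains a particular
  solution for each right-hand side in the kernel, plus the whole kernel through \<open>C\<^sub>3\<close> and \<open>C\<^sub>4\<close>.
  Hence it is the general solution of \<open>L (L u) = 0\<close>.  The same formula is the tension field, which
  vanishes identically only for \<open>C\<^sub>1 = C\<^sub>2 = 0\<close>.
\<close>

section \<open>Smoothness\<close>

lemma higher_differentiable_on_cong:
  assumes "open S" and "\<And>x. x \<in> S \<Longrightarrow> f x = g x"
  shows "higher_differentiable_on S f n \<longleftrightarrow> higher_differentiable_on S g n"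
  using assms(2)
proof (induction n arbitrary: f g)
  case 0
  then show ?case by (auto cong: continuous_on_cong)
next
  case (Suc n)
  have D: "(f has_derivative D) (at x) \<longleftrightarrow> (g has_derivative D) (at x)" if "x \<in> S" for x D
    using has_derivative_transform_within_open[OF _ assms(1) that] Suc.prems by metis
  have "frechet_derivative f (at x) = frechet_derivative g (at x)" if "x \<in> S" for x
    unfolding frechet_derivative_def using D[OF that] by simp
  moreover have "f differentiable (at x) \<longleftrightarrow> g differentiable (at x)" if "x \<in> S" for x
    unfolding differentiable_def using D[OF that] by simp
  ultimately show ?case
    using Suc.IH[of "\<lambda>x. frechet_derivative f (at x) v" "\<lambda>x. frechet_derivative g (at x) v" for v]
    by simp
qed

lemma higher_differentiable_on_SucD:
  "higher_differentiable_on S f (Suc n) \<Longrightarrow> higher_differentiable_on S f n"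
proof (induction n arbitrary: f)
  case 0
  then show ?case
    by (auto intro!: continuous_at_imp_continuous_on differentiable_imp_continuous_within)
next
  case (Suc n)
  then show ?case by (metis higher_differentiable_on.simps(2))
qed

text \<open>
  The recursive definition speaks about \<open>frechet_derivative\<close> at every point; openness allows it to be
  replaced by any explicit derivative on \<open>S\<close> before the next derivative is taken.
\<close>

lemma higher_differentiable_on_SucI:
  assumes "open S" and D: "\<And>x. x \<in> S \<Longrightarrow> (f has_derivative D x) (at x)"
    and "\<And>v. higher_differentiable_on S (\<lambda>x. D x v) n"
  shows "higher_differentiable_on S f (Suc n)"
proof -
  have eq: "frechet_derivative f (at x) v = D x v" if "x \<in> S" for x v
    using frechet_derivative_at[OF D[OF that]] by simp
  have "higher_differentiable_on S (\<lambda>x. frechet_derivative f (at x) v) n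
      \<longleftrightarrow> higher_differentiable_on S (\<lambda>x. D x v) n" for v
    by (rule higher_differentiable_on_cong[OF assms(1)]) (rule eq)
  then show ?thesis using assms(3) D by (auto simp: differentiable_def)
qed

lemma higher_differentiable_on_const: "higher_differentiable_on S (\<lambda>x. c) n"
  by (induction n arbitrary: c) auto

lemma higher_differentiable_on_add:
  assumes "open S" "higher_differentiable_on S f n" "higher_differentiable_on S g n"
  shows "higher_differentiable_on S (\<lambda>x. f x + g x) n"
  using assms(2,3)
proof (induction n arbitrary: f g)
  case 0
  then show ?case by (auto intro: continuous_on_add)
next
  case (Suc n)
  show ?case
  proof (rule higher_differentiable_on_SucI[OF assms(1)])
    show "((\<lambda>x. f x + g x) has_derivative
       (\<lambda>v. frechet_derivative f (at x) v + frechet_derivative g (at x) v)) (at x)" if "x \<in> S" for x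
      using Suc.prems that by (intro has_derivative_add) (auto simp: frechet_derivative_works)
  qed (use Suc in simp)
qed

lemma higher_differentiable_on_mult:
  fixes f g :: "'a::real_normed_vector \<Rightarrow> real"
  assumes "open S" "higher_differentiable_on S f n" "higher_differentiable_on S g n"
  shows "higher_differentiable_on S (\<lambda>x. f x * g x) n"
  using assms(2,3)
proof (induction n arbitrary: f g)
  case 0
  then show ?case by (auto intro: continuous_on_mult)
next
  case (Suc n)
  show ?case
  proof (rule higher_differentiable_on_SucI[OF assms(1)])
    show "((\<lambda>x. f x * g x) has_derivative
       (\<lambda>v. f x * frechet_derivative g (at x) v + frechet_derivative f (at x) v * g x)) (at x)"
      if "x \<in> S" for x
      using Suc.prems that by (intro has_derivative_mult) (auto simp: frechet_derivative_works)
    show "higher_differentiable_on S (\<lambda>x. f x * frechet_derivative g (at x) v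
        + frechet_derivative f (at x) v * g x) n" for v
      using Suc.prems higher_differentiable_on_SucD[OF Suc.prems(1)]
        higher_differentiable_on_SucD[OF Suc.prems(2)]
      by (intro higher_differentiable_on_add[OF assms(1)] Suc.IH) auto
  qed
qed

lemma frechet_derivative_real:
  assumes "(f has_real_derivative d) (at x)"
  shows "frechet_derivative f (at x) v = d * v"
  using frechet_derivative_at[of f "(*) d" x] assms by (simp add: has_field_derivative_def)

lemma higher_differentiable_on_Suc_real:
  fixes f :: "real \<Rightarrow> real"
  assumes "open S" and f': "\<And>x. x \<in> S \<Longrightarrow> (f has_real_derivative f' x) (at x)"
    and "higher_differentiable_on S f' n"
  shows "higher_differentiable_on S f (Suc n)"
proof (rule higher_differentiable_on_SucI[OF assms(1)])
  show "(f has_derivative (*) (f' x)) (at x)" if "x \<in> S" for x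
    using f'[OF that] by (simp add: has_field_derivative_def)
  show "higher_differentiable_on S (\<lambda>x. f' x * v) n" for v
    using assms by (intro higher_differentiable_on_mult higher_differentiable_on_const)
qed

text \<open>
  Regularity by bootstrapping: when \<open>f'\<close> is an expression in \<open>f\<close> and smooth functions, as for
  \<open>tan\<close> and \<open>cot\<close>, it is as regular as \<open>f\<close>, and so \<open>f\<close> gains a derivative at each step.
\<close>

lemma smooth_on_bootstrap:
  fixes f :: "real \<Rightarrow> real"
  assumes "open S" and f': "\<And>x. x \<in> S \<Longrightarrow> (f has_real_derivative f' x) (at x)"
    and step: "\<And>n. higher_differentiable_on S f n \<Longrightarrow> higher_differentiable_on S f' n"
  shows "smooth_on S f"
  unfolding smooth_on_def
proof
  fix n show "higher_differentiable_on S f n"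
  proof (induction n)
    case 0
    then show ?case using f' by (auto intro!: DERIV_isCont continuous_at_imp_continuous_on)
  next
    case (Suc n)
    then show ?case using assms by (intro higher_differentiable_on_Suc_real[where f' = f']) auto
  qed
qed

lemma smooth_on_cong:
  assumes "open S" and "\<And>x. x \<in> S \<Longrightarrow> f x = g x"
  shows "smooth_on S f \<longleftrightarrow> smooth_on S g"
  using higher_differentiable_on_cong[OF assms] by (simp add: smooth_on_def)

lemma smooth_on_const: "smooth_on S (\<lambda>x. c)"
  by (simp add: smooth_on_def higher_differentiable_on_const)

lemma smooth_on_add:
  "open S \<Longrightarrow> smooth_on S f \<Longrightarrow> smooth_on S g \<Longrightarrow> smooth_on S (\<lambda>x. f x + g x)"
  by (simp add: smooth_on_def higher_differentiable_on_add)

lemma smooth_on_mult: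
  fixes f g :: "'a::real_normed_vector \<Rightarrow> real"
  shows "open S \<Longrightarrow> smooth_on S f \<Longrightarrow> smooth_on S g \<Longrightarrow> smooth_on S (\<lambda>x. f x * g x)"
  by (simp add: smooth_on_def higher_differentiable_on_mult)

lemma smooth_on_diff:
  fixes f g :: "'a::real_normed_vector \<Rightarrow> real"
  assumes "open S" "smooth_on S f" "smooth_on S g"
  shows "smooth_on S (\<lambda>x. f x - g x)"
  using smooth_on_add[OF assms(1,2) smooth_on_mult[OF assms(1) smooth_on_const[of _ "-1"] assms(3)]]
  by simp

lemmas smooth_on_intros = smooth_on_const smooth_on_add smooth_on_diff smooth_on_mult

lemma smooth_on_derivative:
  fixes f :: "real \<Rightarrow> real"
  assumes "smooth_on S f"
  obtains f' where "smooth_on S f'" and "\<And>x. x \<in> S \<Longrightarrow> (f has_real_derivative f' x) (at x)"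
proof
  have hd: "higher_differentiable_on S f (Suc n)" for n
    using assms unfolding smooth_on_def by blast
  then show "smooth_on S (\<lambda>x. frechet_derivative f (at x) 1)"
    unfolding smooth_on_def by auto
  fix x assume "x \<in> S"
  then have "f differentiable at x"
    using hd[of 0] by simp
  then show "(f has_real_derivative frechet_derivative f (at x) 1) (at x)"
    by (metis frechet_derivative_real real_differentiable_def mult.right_neutral)
qed

lemma open_polar_domain: "open I \<Longrightarrow> open (polar_domain I)"
  unfolding polar_domain_def by (rule open_vimage_vec_nth[unfolded vimage_def])

lemma has_derivative_first_coordinate:
  fixes f :: "real \<Rightarrow> real" and x :: "real ^ 2"
  assumes "(f has_real_derivative d) (at (x $ 1))"
  shows "((\<lambda>y. f (y $ 1)) has_derivative (\<lambda>v. d * v $ 1)) (at x)"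
  using has_derivative_compose[of "\<lambda>y. y $ 1" "\<lambda>v. v $ 1" x UNIV f "(*) d"] assms
  by (simp add: has_field_derivative_def bounded_linear_imp_has_derivative bounded_linear_vec_nth)

text \<open>
  The derivative in direction \<open>v\<close> has the same shape, with \<open>f'\<close> in place of \<open>f\<close> and \<open>v $ 1 *\<^sub>R c\<close> in
  place of \<open>c\<close>; the factor \<open>c\<close> is there to make the induction go through.
\<close>

lemma higher_differentiable_on_first_coordinate:
  fixes f :: "real \<Rightarrow> real" and c :: "'b::real_normed_vector"
  assumes "open I" and "smooth_on I f"
  shows "higher_differentiable_on (polar_domain I) (\<lambda>x. f (x $ 1) *\<^sub>R c) n"
  using assms(2)
proof (induction n arbitrary: f c)
  case 0
  then have "continuous_on I f"
    unfolding smooth_on_def by (metis higher_differentiable_on.simps(1))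
  then show ?case
    by (auto simp: polar_domain_def
        intro!: continuous_intros continuous_on_compose2[of I f])
next
  case (Suc n)
  obtain f' where f': "smooth_on I f'" "\<And>x. x \<in> I \<Longrightarrow> (f has_real_derivative f' x) (at x)"
    using smooth_on_derivative[OF Suc.prems] by blast
  show ?case
  proof (rule higher_differentiable_on_SucI[OF open_polar_domain[OF assms(1)]])
    show "((\<lambda>x. f (x $ 1) *\<^sub>R c) has_derivative (\<lambda>v. f' (x $ 1) *\<^sub>R (v $ 1 *\<^sub>R c))) (at x)"
      if "x \<in> polar_domain I" for x
      using has_derivative_scaleR_left[OF has_derivative_first_coordinate[OF f'(2)], of x c] that
      by (simp add: polar_domain_def)
    show "higher_differentiable_on (polar_domain I) (\<lambda>x. f' (x $ 1) *\<^sub>R (v $ 1 *\<^sub>R c)) n"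
      for v :: "real ^ 2"
      by (rule Suc.IH[OF f'(1)])
  qed
qed

lemma higher_differentiable_on_bounded_linear:
  assumes "bounded_linear f"
  shows "higher_differentiable_on S f n"
proof (cases n)
  case 0
  then show ?thesis using assms by (auto intro: linear_continuous_on)
next
  case (Suc m)
  have D: "(f has_derivative f) (at x)" for x
    by (rule bounded_linear_imp_has_derivative[OF assms])
  then have "frechet_derivative f (at x) = f" for x
    by (metis frechet_derivative_at)
  then show ?thesis
    using Suc D by (auto simp: differentiable_def higher_differentiable_on_const)
qed

lemma smooth_on_rot_map:
  assumes "open I" and "smooth_on I \<rho>"
  shows "smooth_on (polar_domain I) (rot_map \<rho>)"
proof -
  have eq: "rot_map \<rho> = (\<lambda>x. \<rho> (x $ 1) *\<^sub>R axis 1 1 + x $ 2 *\<^sub>R axis 2 1)"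
    by (auto simp: rot_map_def vec_eq_iff forall_2 axis_def)
  have "bounded_linear (\<lambda>x :: real ^ 2. x $ 2 *\<^sub>R (axis 2 1 :: real ^ 2))"
    by (intro bounded_linear_scaleR_left[THEN bounded_linear_compose] bounded_linear_vec_nth)
  then show ?thesis
    unfolding smooth_on_def eq
    by (intro allI higher_differentiable_on_add open_polar_domain assms
        higher_differentiable_on_first_coordinate
        higher_differentiable_on_bounded_linear[where f = "\<lambda>x. x $ 2 *\<^sub>R _"])
qed

section \<open>Rotationally symmetric metrics\<close>

lemma matrix_inv_eqI:
  fixes A :: "'a::semiring_1 ^ 'n ^ 'm"
  assumes "A ** B = mat 1" and "B ** A = mat 1"
  shows "matrix_inv A = B"
proof -
  have "A ** matrix_inv A = mat 1"
    unfolding matrix_inv_def using someI[of "\<lambda>X. A ** X = mat 1 \<and> X ** A = mat 1" B] assms by simp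
  then have "B ** (A ** matrix_inv A) = B" by simp
  then show ?thesis by (simp add: matrix_mul_assoc assms(2))
qed

lemma matrix_inv_rotational_metric:
  assumes "w (x $ 1) \<noteq> 0"
  shows "matrix_inv (rotational_metric w x) = vector [vector [1, 0], vector [0, 1 / w (x $ 1)]]"
proof (rule matrix_inv_eqI)
  show "rotational_metric w x ** vector [vector [1, 0], vector [0, 1 / w (x $ 1)]] = mat 1"
    "vector [vector [1, 0], vector [0, 1 / w (x $ 1)]] ** rotational_metric w x = mat 1"
    using assms by (auto simp: rotational_metric_def matrix_matrix_mult_def mat_def vec_eq_iff
        forall_2 sum_2)
qed

lemma christoffel_form_rotational_metric:
  assumes "(w has_real_derivative d) (at (x $ 1))" and "w (x $ 1) \<noteq> 0"
  shows "christoffel_form (rotational_metric w) x u v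
    = vector [- (d / 2) * (u $ 2 * v $ 2), d / (2 * w (x $ 1)) * (u $ 1 * v $ 2 + u $ 2 * v $ 1)]"
proof -
  have D: "frechet_derivative (\<lambda>y. w (y $ 1)) (at x) = (\<lambda>v. d * v $ 1)"
    using frechet_derivative_at[OF has_derivative_first_coordinate[OF assms(1)]] by simp
  show ?thesis
    unfolding christoffel_form_def christoffel_def partial_def
      matrix_inv_rotational_metric[where w = w, OF assms(2)]
    using assms(2)
    by (simp add: vec_eq_iff forall_2 sum_2 rotational_metric_def D axis_def field_simps)
qed

lemma metric_trace_rotational_metric:
  assumes "s (x $ 1) \<noteq> 0"
  shows "metric_trace (rotational_metric s) B x
    = B (frame 1) (frame 1) x + (1 / s (x $ 1)) *\<^sub>R B (frame 2) (frame 2) x"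
  by (simp add: metric_trace_def matrix_inv_rotational_metric[where w = s, OF assms] sum_2)

text \<open>
  All sections that occur are functions of the first coordinate, but only on the polar domain, where
  the closed formulas for \<open>\<phi>\<close> and its derivatives hold; openness of \<open>I\<close> makes this enough.
\<close>

lemma frechet_derivative_first_coordinate_vector:
  fixes V :: "real ^ 2 \<Rightarrow> real ^ 2"
  assumes "open I" and "x $ 1 \<in> I"
    and V: "\<And>y. y $ 1 \<in> I \<Longrightarrow> V y = vector [a (y $ 1), b (y $ 1)]"
    and a: "(a has_real_derivative a') (at (x $ 1))"
    and b: "(b has_real_derivative b') (at (x $ 1))"
  shows "frechet_derivative V (at x) v = vector [a' * v $ 1, b' * v $ 1]"
proof -
  have "((\<lambda>y. a (y $ 1) *\<^sub>R axis 1 1 + b (y $ 1) *\<^sub>R axis 2 1 :: real ^ 2) has_derivative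
      (\<lambda>v. (a' * v $ 1) *\<^sub>R axis 1 1 + (b' * v $ 1) *\<^sub>R axis 2 1)) (at x)"
    by (intro has_derivative_add has_derivative_scaleR_left has_derivative_first_coordinate a b)
  then have "(V has_derivative (\<lambda>v. (a' * v $ 1) *\<^sub>R axis 1 1 + (b' * v $ 1) *\<^sub>R axis 2 1)) (at x)"
    by (rule has_derivative_transform_within_open[OF _ open_polar_domain[OF assms(1)]])
      (auto simp: polar_domain_def assms(2) V vec_eq_iff forall_2 axis_def)
  from frechet_derivative_at[OF this, symmetric] show ?thesis
    by (simp add: vec_eq_iff forall_2 axis_def)
qed

text \<open>
  The two components are those of the surface of Gauss curvature \<open>K = w'\<^sup>2 / (4 w\<^sup>2) - w'' / (2 w)\<close>,
  that is \<open>R(u, v) z = K (\<langle>v, z\<rangle> u - \<langle>u, z\<rangle> v)\<close> written out in coordinates.  The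
  derivative terms are those of the Christoffel symbols alone, all three fields having constant
  components.
\<close>

lemma curvature_at_rotational_metric:
  assumes "open J" and "p $ 1 \<in> J"
    and w: "\<And>t. t \<in> J \<Longrightarrow> w t \<noteq> 0" "\<And>t. t \<in> J \<Longrightarrow> (w has_real_derivative w' t) (at t)"
    and w'': "(w' has_real_derivative k) (at (p $ 1))"
  shows "curvature_at (rotational_metric w) p u v z
    = ((u $ 1 * v $ 2 - u $ 2 * v $ 1) * ((w' (p $ 1))\<^sup>2 / (4 * w (p $ 1)) - k / 2))
      *\<^sub>R vector [z $ 2, - z $ 1 / w (p $ 1)]"
proof -
  let ?h = "rotational_metric w"
  have G: "christoffel_form ?h y u v = vector [- (w' (y $ 1) / 2) * (u $ 2 * v $ 2),
      w' (y $ 1) / (2 * w (y $ 1)) * (u $ 1 * v $ 2 + u $ 2 * v $ 1)]" if "y $ 1 \<in> J" for y u v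
    by (rule christoffel_form_rotational_metric) (use w that in auto)
  have LC: "levi_civita ?h (\<lambda>_. u) (\<lambda>_. v) = (\<lambda>y. christoffel_form ?h y u v)" for u v
    by (simp add: levi_civita_def fun_eq_iff)
  \<comment> \<open>the derivative of \<open>w' / (2 w)\<close>\<close>
  define m' where "m' = (k * w (p $ 1) - w' (p $ 1) * w' (p $ 1)) / (2 * (w (p $ 1))\<^sup>2)"
  have D: "frechet_derivative (\<lambda>y. christoffel_form ?h y u v) (at p) z
    = vector [(- (k / 2) * (u $ 2 * v $ 2)) * z $ 1, (m' * (u $ 1 * v $ 2 + u $ 2 * v $ 1)) * z $ 1]"
    for u v z
    by (rule frechet_derivative_first_coordinate_vector[OF assms(1,2),
        where a = "\<lambda>t. - (w' t / 2) * (u $ 2 * v $ 2)"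
          and b = "\<lambda>t. w' t / (2 * w t) * (u $ 1 * v $ 2 + u $ 2 * v $ 1)", OF G])
      (use w[OF assms(2)] w'' in \<open>auto intro!: derivative_eq_intros
        simp: m'_def field_simps power2_eq_square\<close>)
  have R: "curvature_at ?h p u v z =
      frechet_derivative (\<lambda>y. christoffel_form ?h y v z) (at p) u
        + christoffel_form ?h p u (christoffel_form ?h p v z)
      - (frechet_derivative (\<lambda>y. christoffel_form ?h y u z) (at p) v
        + christoffel_form ?h p v (christoffel_form ?h p u z))"
    unfolding curvature_at_def curvature_def LC
    by (simp add: levi_civita_def lie_bracket_def G assms vec_eq_iff forall_2)
  show ?thesis
    unfolding R D G[OF assms(2)] m'_def using w(1)[OF assms(2)]
    by (simp add: vec_eq_iff forall_2 field_simps power2_eq_square)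
qed

section \<open>Tension and bitension of a rotationally symmetric map\<close>

text \<open>
  A map \<open>(r, \<theta>) \<mapsto> (\<rho>(r), \<theta>)\<close> from \<open>dr\<^sup>2 + s(r) d\<theta>\<^sup>2\<close> to \<open>d\<rho>\<^sup>2 + w(\<rho>) d\<phi>\<^sup>2\<close>.
\<close>

locale rotational_map =
  fixes I J :: "real set" and s s' w w' w'' \<rho> \<rho>' :: "real \<Rightarrow> real"
  assumes open_I: "open I" and open_J: "open J"
    and s: "\<And>r. r \<in> I \<Longrightarrow> s r \<noteq> 0" "\<And>r. r \<in> I \<Longrightarrow> (s has_real_derivative s' r) (at r)"
    and w: "\<And>t. t \<in> J \<Longrightarrow> w t \<noteq> 0" "\<And>t. t \<in> J \<Longrightarrow> (w has_real_derivative w' t) (at t)"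
    and w': "\<And>t. t \<in> J \<Longrightarrow> (w' has_real_derivative w'' t) (at t)"
    and \<rho>: "\<And>r. r \<in> I \<Longrightarrow> \<rho> r \<in> J" "\<And>r. r \<in> I \<Longrightarrow> (\<rho> has_real_derivative \<rho>' r) (at r)"
begin

abbreviation "g \<equiv> rotational_metric s"
abbreviation "h \<equiv> rotational_metric w"
abbreviation "\<phi> \<equiv> rot_map \<rho>"

lemma differential_rot_map:
  assumes "x $ 1 \<in> I"
  shows "differential \<phi> X x = vector [\<rho>' (x $ 1) * X x $ 1, X x $ 2]"
proof -
  have eq: "\<phi> = (\<lambda>x. \<rho> (x $ 1) *\<^sub>R axis 1 1 + x $ 2 *\<^sub>R axis 2 1)"
    by (auto simp: rot_map_def vec_eq_iff forall_2 axis_def)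
  have "(\<phi> has_derivative (\<lambda>v. (\<rho>' (x $ 1) * v $ 1) *\<^sub>R axis 1 1 + v $ 2 *\<^sub>R axis 2 1)) (at x)"
    unfolding eq using \<rho>(2)[OF assms]
    by (intro has_derivative_add has_derivative_scaleR_left has_derivative_first_coordinate
        bounded_linear_imp_has_derivative bounded_linear_vec_nth)
  from frechet_derivative_at[OF this, symmetric] show ?thesis
    by (simp add: differential_def vec_eq_iff forall_2 axis_def)
qed

lemma pullback_connection_rot_map:
  assumes x: "x $ 1 \<in> I"
    and V: "\<And>y. y $ 1 \<in> I \<Longrightarrow> V y = vector [a (y $ 1), b (y $ 1)]"
    and ab: "(a has_real_derivative a') (at (x $ 1))" "(b has_real_derivative b') (at (x $ 1))"
  shows "pullback_connection h \<phi> X V x =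
    vector [a' * X x $ 1 - w' (\<rho> (x $ 1)) / 2 * b (x $ 1) * X x $ 2,
      b' * X x $ 1 + w' (\<rho> (x $ 1)) / (2 * w (\<rho> (x $ 1)))
        * (\<rho>' (x $ 1) * b (x $ 1) * X x $ 1 + a (x $ 1) * X x $ 2)]"
proof -
  have G: "christoffel_form h (\<phi> x) u v = vector [- (w' (\<rho> (x $ 1)) / 2) * (u $ 2 * v $ 2),
      w' (\<rho> (x $ 1)) / (2 * w (\<rho> (x $ 1))) * (u $ 1 * v $ 2 + u $ 2 * v $ 1)]" for u v
    using christoffel_form_rotational_metric[of w "w' (\<rho> (x $ 1))" "\<phi> x"] w \<rho>(1)[OF x]
    by (simp add: rot_map_def)
  have D: "frechet_derivative V (at x) v = vector [a' * v $ 1, b' * v $ 1]" for v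
    by (rule frechet_derivative_first_coordinate_vector[OF open_I x V ab])
  show ?thesis
    unfolding pullback_connection_def G differential_rot_map[OF x] V[OF x] D
    by (simp add: vec_eq_iff forall_2 algebra_simps)
qed

lemma levi_civita_frame:
  assumes "x $ 1 \<in> I"
  shows "levi_civita g (frame 1) (frame 1) x = vector [0, 0]"
    and "levi_civita g (frame 2) (frame 2) x = vector [- (s' (x $ 1) / 2), 0]"
  unfolding levi_civita_def
    christoffel_form_rotational_metric[where w = s, OF s(2)[OF assms] s(1)[OF assms]]
  by (simp_all add: frame_def vec_eq_iff forall_2 axis_def)

lemma tension_field_rot_map:
  assumes "x $ 1 \<in> I" and "(\<rho>' has_real_derivative d) (at (x $ 1))"
  shows "tension_field g h \<phi> x = vector
    [d + s' (x $ 1) / (2 * s (x $ 1)) * \<rho>' (x $ 1) - w' (\<rho> (x $ 1)) / (2 * s (x $ 1)), 0]"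
proof -
  have 1: "pullback_connection h \<phi> (frame 1) (differential \<phi> (frame 1)) x = vector [d, 0]"
    using pullback_connection_rot_map[of x "differential \<phi> (frame 1)" \<rho>' "\<lambda>_. 0" d 0 "frame 1"] assms
    by (simp add: differential_rot_map frame_def axis_def)
  have 2: "pullback_connection h \<phi> (frame 2) (differential \<phi> (frame 2)) x
      = vector [- (w' (\<rho> (x $ 1)) / 2), 0]"
    using pullback_connection_rot_map[of x "differential \<phi> (frame 2)" "\<lambda>_. 0" "\<lambda>_. 1" 0 0 "frame 2"] assms
    by (simp add: differential_rot_map frame_def axis_def)
  show ?thesis
    unfolding tension_field_def metric_trace_rotational_metric[where s = s, OF s(1)[OF assms(1)]] 1 2
      levi_civita_frame[OF assms(1)] differential_rot_map[OF assms(1)]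
    using s(1)[OF assms(1)] by (simp add: vec_eq_iff forall_2 field_simps)
qed

text \<open>
  Differentiating \<open>(F, 0)\<close> twice in the angular direction gives \<open>(- w'\<^sup>2 F / (4 w), 0)\<close>, because the
  frame rotates along the image circle.  The curvature term is \<open>(w'' / 2 - w'\<^sup>2 / (4 w)) F\<close> in the
  same direction, both up to the factor \<open>1 / s\<close>, so that only \<open>w''\<close> survives in the difference.
\<close>

lemma bitension_field_rot_map:
  assumes x: "x $ 1 \<in> I"
    and \<tau>: "\<And>y. y $ 1 \<in> I \<Longrightarrow> tension_field g h \<phi> y = vector [F (y $ 1), 0]"
    and F: "\<And>r. r \<in> I \<Longrightarrow> (F has_real_derivative F' r) (at r)"
    and F': "(F' has_real_derivative d) (at (x $ 1))"
  shows "bitension_field g h \<phi> x = vector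
    [d + s' (x $ 1) / (2 * s (x $ 1)) * F' (x $ 1) - w'' (\<rho> (x $ 1)) * F (x $ 1) / (2 * s (x $ 1)), 0]"
proof -
  let ?\<tau> = "tension_field g h \<phi>"
  define m where "m r = w' (\<rho> r) / (2 * w (\<rho> r))" for r
  have D\<tau>: "pullback_connection h \<phi> X ?\<tau> y
      = vector [F' (y $ 1) * X y $ 1, m (y $ 1) * (F (y $ 1) * X y $ 2)]" if "y $ 1 \<in> I" for X y
    using pullback_connection_rot_map[of y ?\<tau> F "\<lambda>_. 0" "F' (y $ 1)" 0 X] that \<tau> F
    by (simp add: m_def)
  have comp: "((\<lambda>r. f (\<rho> r)) has_real_derivative f' (\<rho> r) * \<rho>' r) (at r)"
    if "\<And>t. t \<in> J \<Longrightarrow> (f has_real_derivative f' t) (at t)" and "r \<in> I" for f f' r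
    using DERIV_chain2[of f "f' (\<rho> r)" \<rho> r "\<rho>' r" UNIV] that \<rho> by simp
  \<comment> \<open>the value \<open>c\<close> drops out, since the frame field \<open>frame 2\<close> has no radial component\<close>
  obtain c where c: "((\<lambda>r. m r * F r) has_real_derivative c) (at (x $ 1))"
  proof -
    have "(\<lambda>r. w' (\<rho> r)) field_differentiable at (x $ 1)"
      "(\<lambda>r. w (\<rho> r)) field_differentiable at (x $ 1)" "F field_differentiable at (x $ 1)"
      using comp[OF w'] comp[OF w(2)] F x unfolding field_differentiable_def by blast+
    then have "(\<lambda>r. m r * F r) field_differentiable at (x $ 1)"
      unfolding m_def using w(1)[OF \<rho>(1)[OF x]] by (intro derivative_intros) auto
    then show thesis using that by (auto simp: field_differentiable_def)
  qed
  have 1: "pullback_connection h \<phi> (frame 1) (pullback_connection h \<phi> (frame 1) ?\<tau>) x = vector [d, 0]"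
    using pullback_connection_rot_map[of x "pullback_connection h \<phi> (frame 1) ?\<tau>" F' "\<lambda>_. 0" d 0 "frame 1"]
      x F' by (simp add: D\<tau> frame_def axis_def)
  have 2: "pullback_connection h \<phi> (frame 2) (pullback_connection h \<phi> (frame 2) ?\<tau>) x
      = vector [- (w' (\<rho> (x $ 1)) / 2 * (m (x $ 1) * F (x $ 1))), 0]"
    using pullback_connection_rot_map[of x "pullback_connection h \<phi> (frame 2) ?\<tau>" "\<lambda>_. 0"
        "\<lambda>r. m r * F r" 0 c "frame 2"] x c
    by (simp add: D\<tau> frame_def axis_def)
  have J: "\<phi> x $ 1 \<in> J" and \<phi>: "\<phi> x $ 1 = \<rho> (x $ 1)"
    using \<rho>(1)[OF x] by (simp_all add: rot_map_def)
  note R = curvature_at_rotational_metric[where w = w, OF open_J J w w'[OF J], unfolded \<phi>]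
  have R1: "curvature_at h (\<phi> x) (differential \<phi> (frame 1) x) (?\<tau> x) (differential \<phi> (frame 1) x)
      = vector [0, 0]"
    by (simp add: R vec_eq_iff forall_2 differential_rot_map[OF x] \<tau>[OF x] frame_def axis_def)
  have R2: "curvature_at h (\<phi> x) (differential \<phi> (frame 2) x) (?\<tau> x) (differential \<phi> (frame 2) x)
      = vector [F (x $ 1) * (w'' (\<rho> (x $ 1)) / 2 - (w' (\<rho> (x $ 1)))\<^sup>2 / (4 * w (\<rho> (x $ 1)))), 0]"
    by (simp add: R vec_eq_iff forall_2 differential_rot_map[OF x] \<tau>[OF x] frame_def axis_def
        algebra_simps)
  show ?thesis
    unfolding bitension_field_def metric_trace_rotational_metric[where s = s, OF s(1)[OF x]]
      1 2 R1 R2 D\<tau>[OF x] levi_civita_frame[OF x]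
    using s(1)[OF x] w(1)[OF \<rho>(1)[OF x]]
    by (simp add: vec_eq_iff forall_2 m_def field_simps power2_eq_square)
qed

end

section \<open>The radial equation on the sphere\<close>

text \<open>
  The operator \<open>L y = y'' + cot r y' - y / sin\<^sup>2 r\<close> at the point \<open>r\<close>.  The derivatives are arguments,
  so that it can be applied to functions which are only controlled on an interval.
\<close>

definition radial_op :: "real \<Rightarrow> real \<Rightarrow> real \<Rightarrow> real \<Rightarrow> real" where
  "radial_op r y y' y'' = y'' + cot r * y' - y / (sin r)\<^sup>2"

lemma half_angle:
  fixes r :: real
  assumes "r \<in> {0<..<pi}"
  shows tan_half_pos: "tan (r/2) > 0"
    and cot_half: "cot (r/2) = 1 / tan (r/2)"
    and sin_half_tan: "sin r = 2 * tan (r/2) / (1 + (tan (r/2))\<^sup>2)"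
    and cot_half_tan: "cot r = (1 - (tan (r/2))\<^sup>2) / (2 * tan (r/2))"
    and tan_half_deriv: "((\<lambda>r. tan (r/2)) has_real_derivative (1 + (tan (r/2))\<^sup>2) / 2) (at r)"
proof -
  show T: "tan (r/2) > 0" using assms by (intro tan_gt_zero) auto
  have c: "cos (r/2) > 0" using assms by (intro cos_gt_zero_pi) auto
  have sec: "1 + (tan (r/2))\<^sup>2 = 1 / (cos (r/2))\<^sup>2"
    using tan_sec[of "r/2"] c by (simp add: power_divide inverse_eq_divide)
  show "cot (r/2) = 1 / tan (r/2)" by (simp add: cot_def tan_def)
  show S: "sin r = 2 * tan (r/2) / (1 + (tan (r/2))\<^sup>2)"
    unfolding sec using c sin_double[of "r/2"] by (simp add: tan_def field_simps power2_eq_square)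
  have C: "cos r = (1 - (tan (r/2))\<^sup>2) / (1 + (tan (r/2))\<^sup>2)"
    using cos_double[of "r/2"] c unfolding sec
    by (simp add: tan_def power_divide left_diff_distrib)
  have "1 + (tan (r/2))\<^sup>2 \<noteq> 0" using c by (simp add: sec)
  then show "cot r = (1 - (tan (r/2))\<^sup>2) / (2 * tan (r/2))"
    unfolding cot_def S C by simp
  show "((\<lambda>r. tan (r/2)) has_real_derivative (1 + (tan (r/2))\<^sup>2) / 2) (at r)"
    unfolding sec using c by (auto intro!: derivative_eq_intros simp: inverse_eq_divide)
qed

lemma cot_half_deriv:
  fixes r :: real
  assumes "r \<in> {0<..<pi}"
  shows "((\<lambda>r. cot (r/2)) has_real_derivative - (1 + (cot (r/2))\<^sup>2) / 2) (at r)"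
proof -
  have s: "sin (r/2) > 0" using assms by (intro sin_gt_zero) auto
  have "1 + (cot (r/2))\<^sup>2 = 1 / (sin (r/2))\<^sup>2"
    using s by (simp add: cot_def power_divide field_simps)
  then show ?thesis
    using DERIV_chain2[OF DERIV_cot[of "r/2"] DERIV_cdivide[OF DERIV_ident, of 2 r]] s
    by (simp add: inverse_eq_divide)
qed

lemma radial_op_half_angle:
  assumes "r \<in> {0<..<pi}"
  shows "radial_op r y y' y'' = y'' + (1 - (tan (r/2))\<^sup>2) / (2 * tan (r/2)) * y'
    - (1 + (tan (r/2))\<^sup>2)\<^sup>2 / (4 * (tan (r/2))\<^sup>2) * y"
  using tan_half_pos[OF assms]
  by (simp add: radial_op_def cot_half_tan[OF assms] sin_half_tan[OF assms] power_divide power_mult_distrib)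

lemma derivative_eq_on_open:
  fixes f g :: "real \<Rightarrow> real"
  assumes "open I" "\<And>r. r \<in> I \<Longrightarrow> f r = g r"
    and "\<And>r. r \<in> I \<Longrightarrow> (f has_real_derivative f' r) (at r)"
    and "\<And>r. r \<in> I \<Longrightarrow> (g has_real_derivative g' r) (at r)"
    and "r \<in> I"
  shows "f' r = g' r"
proof (rule DERIV_unique)
  show "(f has_real_derivative f' r) (at r)" using assms by blast
  show "(f has_real_derivative g' r) (at r)"
    using has_field_derivative_transform_within_open[OF assms(4)[OF assms(5)] assms(1,5)] assms(2)
    by simp
qed

lemma radial_op_cong:
  fixes f g :: "real \<Rightarrow> real"
  assumes "open I" "\<And>r. r \<in> I \<Longrightarrow> f r = g r"
    and f: "\<And>r. r \<in> I \<Longrightarrow> (f has_real_derivative f' r) (at r)"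
      "\<And>r. r \<in> I \<Longrightarrow> (f' has_real_derivative f'' r) (at r)"
    and g: "\<And>r. r \<in> I \<Longrightarrow> (g has_real_derivative g' r) (at r)"
      "\<And>r. r \<in> I \<Longrightarrow> (g' has_real_derivative g'' r) (at r)"
    and "r \<in> I"
  shows "radial_op r (f r) (f' r) (f'' r) = radial_op r (g r) (g' r) (g'' r)"
proof -
  have 1: "f' r = g' r" if "r \<in> I" for r
    using derivative_eq_on_open[OF assms(1,2) f(1) g(1) that] by simp
  have 2: "f'' r = g'' r" if "r \<in> I" for r
    using derivative_eq_on_open[OF assms(1) 1 f(2) g(2) that] by simp
  show ?thesis using 1 2 assms by simp
qed

text \<open>
  In the variable \<open>t = ln (tan (r/2))\<close>, for which \<open>d/dt = sin r d/dr\<close>, the equation reads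
  \<open>G\<^sub>t\<^sub>t = G\<close>.  The quantities \<open>A\<close> and \<open>B\<close> below are the first integrals
  \<open>(G + G\<^sub>t) exp (-t)\<close> and \<open>(G - G\<^sub>t) exp t\<close> of this equation.
\<close>

lemma radial_op_kernel:
  assumes I: "convex I" "I \<subseteq> {0<..<pi}"
    and G: "\<And>r. r \<in> I \<Longrightarrow> (G has_real_derivative G' r) (at r)"
      "\<And>r. r \<in> I \<Longrightarrow> (G' has_real_derivative G'' r) (at r)"
    and eq: "\<And>r. r \<in> I \<Longrightarrow> radial_op r (G r) (G' r) (G'' r) = 0"
  obtains a b where "\<And>r. r \<in> I \<Longrightarrow> G r = a * tan (r/2) + b * cot (r/2)"
proof -
  define A where "A = (\<lambda>r. (G r + sin r * G' r) * cot (r/2))"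
  define B where "B = (\<lambda>r. (G r - sin r * G' r) * tan (r/2))"
  have deriv: "(A has_real_derivative 0) (at r)" "(B has_real_derivative 0) (at r)" if "r \<in> I" for r
  proof -
    have r: "r \<in> {0<..<pi}" using that I by blast
    define T where "T = tan (r/2)"
    have T: "T > 0" "1 + T\<^sup>2 \<noteq> 0"
      using tan_half_pos[OF r] by (auto simp: T_def add_nonneg_eq_0_iff)
    have s: "sin r = 2 * T / (1 + T\<^sup>2)" using sin_half_tan[OF r] by (simp add: T_def)
    have "sin r > 0" using r by (intro sin_gt_zero) auto
    have "cos r = cot r * sin r" using \<open>sin r > 0\<close> by (simp add: cot_def)
    then have c: "cos r = (1 - T\<^sup>2) / (1 + T\<^sup>2)"
      using T unfolding cot_half_tan[OF r] s T_def[symmetric] by simp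
    have "G'' r = G r / (sin r)\<^sup>2 - cos r / sin r * G' r"
      using eq[OF that] by (simp add: radial_op_def cot_def)
    then have "sin r * G'' r = G r / sin r - cos r * G' r"
      using \<open>sin r > 0\<close> by (simp add: right_diff_distrib power2_eq_square)
    then have sG'': "sin r * G'' r = (1 + T\<^sup>2) / (2 * T) * G r - (1 - T\<^sup>2) / (1 + T\<^sup>2) * G' r"
      unfolding s c by simp
    have "(A has_real_derivative (G' r + (cos r * G' r + sin r * G'' r)) * cot (r/2)
        + (G r + sin r * G' r) * (- (1 + (cot (r/2))\<^sup>2) / 2)) (at r)"
      unfolding A_def
      by (rule DERIV_cong[OF DERIV_mult[OF DERIV_add[OF G(1)[OF that] DERIV_mult[OF DERIV_sin
          G(2)[OF that]]] cot_half_deriv[OF r]]]) (simp add: algebra_simps)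
    moreover have "(G' r + (cos r * G' r + sin r * G'' r)) * cot (r/2)
        + (G r + sin r * G' r) * (- (1 + (cot (r/2))\<^sup>2) / 2) = 0"
      unfolding sG'' unfolding s c cot_half[OF r] T_def[symmetric] using T
      by (simp add: divide_simps) (simp add: algebra_simps power2_eq_square)
    ultimately show "(A has_real_derivative 0) (at r)" by simp
    have "(B has_real_derivative (G' r - (cos r * G' r + sin r * G'' r)) * tan (r/2)
        + (G r - sin r * G' r) * ((1 + (tan (r/2))\<^sup>2) / 2)) (at r)"
      unfolding B_def
      by (rule DERIV_cong[OF DERIV_mult[OF DERIV_diff[OF G(1)[OF that] DERIV_mult[OF DERIV_sin
          G(2)[OF that]]] tan_half_deriv[OF r]]]) (simp add: algebra_simps)
    moreover have "(G' r - (cos r * G' r + sin r * G'' r)) * tan (r/2)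
        + (G r - sin r * G' r) * ((1 + (tan (r/2))\<^sup>2) / 2) = 0"
      unfolding sG'' unfolding s c T_def[symmetric] using T
      by (simp add: divide_simps)
    ultimately show "(B has_real_derivative 0) (at r)" by simp
  qed
  obtain a where a: "\<And>r. r \<in> I \<Longrightarrow> A r = a"
    using has_field_derivative_zero_constant[OF I(1), of A] deriv(1) has_field_derivative_at_within
    by metis
  obtain b where b: "\<And>r. r \<in> I \<Longrightarrow> B r = b"
    using has_field_derivative_zero_constant[OF I(1), of B] deriv(2) has_field_derivative_at_within
    by metis
  show thesis
  proof
    fix r assume "r \<in> I"
    then have r: "r \<in> {0<..<pi}" using I by blast
    have "2 * G r = A r * tan (r/2) + B r * cot (r/2)"
      using tan_half_pos[OF r] by (simp add: A_def B_def cot_half[OF r])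
    then show "G r = a / 2 * tan (r/2) + b / 2 * cot (r/2)"
      using a b \<open>r \<in> I\<close> by simp
  qed
qed

lemma half_angle_combination_deriv:
  fixes a b r :: real
  assumes "r \<in> {0<..<pi}"
  shows "((\<lambda>r. a * cot (r/2) + b * tan (r/2)) has_real_derivative
      - a * (1 + (cot (r/2))\<^sup>2) / 2 + b * (1 + (tan (r/2))\<^sup>2) / 2) (at r)"
  by (rule DERIV_cong[OF DERIV_add[OF DERIV_cmult[OF cot_half_deriv[OF assms]]
        DERIV_cmult[OF tan_half_deriv[OF assms]]]]) (simp add: algebra_simps)

lemma half_angle_combination_deriv2:
  fixes a b r :: real
  assumes "r \<in> {0<..<pi}"
  shows "((\<lambda>r. - a * (1 + (cot (r/2))\<^sup>2) / 2 + b * (1 + (tan (r/2))\<^sup>2) / 2) has_real_derivative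
      a * cot (r/2) * (1 + (cot (r/2))\<^sup>2) / 2 + b * tan (r/2) * (1 + (tan (r/2))\<^sup>2) / 2) (at r)"
proof -
  define T K :: "real \<Rightarrow> real" where "T = (\<lambda>r. tan (r/2))" and "K = (\<lambda>r. cot (r/2))"
  have D: "(T has_real_derivative (1 + (T r)\<^sup>2) / 2) (at r)"
    "(K has_real_derivative - (1 + (K r)\<^sup>2) / 2) (at r)"
    unfolding T_def K_def using tan_half_deriv[OF assms] cot_half_deriv[OF assms] by simp_all
  have "((\<lambda>r. - a * (1 + (K r)\<^sup>2) / 2 + b * (1 + (T r)\<^sup>2) / 2) has_real_derivative
      a * K r * (1 + (K r)\<^sup>2) / 2 + b * T r * (1 + (T r)\<^sup>2) / 2) (at r)"
    by (rule derivative_eq_intros D refl | simp)+ (simp add: field_simps)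
  then show ?thesis by (simp add: T_def K_def)
qed

lemma radial_op_half_angle_combination:
  assumes "r \<in> {0<..<pi}"
  shows "radial_op r (a * cot (r/2) + b * tan (r/2))
    (- a * (1 + (cot (r/2))\<^sup>2) / 2 + b * (1 + (tan (r/2))\<^sup>2) / 2)
    (a * cot (r/2) * (1 + (cot (r/2))\<^sup>2) / 2 + b * tan (r/2) * (1 + (tan (r/2))\<^sup>2) / 2) = 0"
  unfolding radial_op_half_angle[OF assms] cot_half[OF assms] using tan_half_pos[OF assms]
  by (simp add: divide_simps) (simp add: algebra_simps power2_eq_square)

lemma rho_family_half_angle:
  assumes "r \<in> {0<..<pi}"
  shows "rho_family C\<^sub>0 C\<^sub>1 C\<^sub>2 C\<^sub>3 C\<^sub>4 r =
    (C\<^sub>1 - C\<^sub>2 + C\<^sub>3) * cot (r/2) + (2 * C\<^sub>1 * ln (tan (r/2)) + C\<^sub>4) * tan (r/2)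
     - (C\<^sub>1 * tan (r/2) + C\<^sub>2 * cot (r/2)) * ln (1 + (tan (r/2))\<^sup>2) - C\<^sub>0"
  using tan_half_pos[OF assms] by (simp add: rho_family_def cot_half[OF assms])

lemma ln_tan_half_deriv:
  fixes r :: real
  assumes "r \<in> {0<..<pi}"
  shows "((\<lambda>r. ln (tan (r/2))) has_real_derivative (tan (r/2) + cot (r/2)) / 2) (at r)"
  by (rule DERIV_cong[OF DERIV_chain2[OF DERIV_ln_divide[OF tan_half_pos] tan_half_deriv]])
    (use assms tan_half_pos[OF assms] in \<open>simp_all add: cot_half[OF assms] field_simps power2_eq_square\<close>)

lemma ln_sec_half_deriv:
  fixes r :: real
  assumes "r \<in> {0<..<pi}"
  shows "((\<lambda>r. ln (1 + (tan (r/2))\<^sup>2)) has_real_derivative tan (r/2)) (at r)"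
proof -
  have pos: "1 + (tan (r/2))\<^sup>2 > 0" by (simp add: add_pos_nonneg)
  have "((\<lambda>r. 1 + (tan (r/2))\<^sup>2) has_real_derivative (1 + (tan (r/2))\<^sup>2) * tan (r/2)) (at r)"
    by (rule DERIV_cong[OF DERIV_add[OF DERIV_const DERIV_power[OF tan_half_deriv[OF assms]]]]) simp
  from DERIV_chain2[OF DERIV_ln_divide[OF pos] this] show ?thesis
    using pos by simp
qed

lemma smooth_on_half_angle:
  assumes "open I" and "I \<subseteq> {0<..<pi}"
  shows "smooth_on I (\<lambda>r. tan (r/2))" and "smooth_on I (\<lambda>r. cot (r/2))"
    and "smooth_on I (\<lambda>r. ln (tan (r/2)))" and "smooth_on I (\<lambda>r. ln (1 + (tan (r/2))\<^sup>2))"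
proof -
  have I: "r \<in> {0<..<pi}" if "r \<in> I" for r using that assms by blast
  note hd = higher_differentiable_on_add[OF assms(1)] higher_differentiable_on_mult[OF assms(1)]
    higher_differentiable_on_const
  show T: "smooth_on I (\<lambda>r. tan (r/2))"
  proof (rule smooth_on_bootstrap[OF assms(1) tan_half_deriv[OF I]])
    fix n assume "higher_differentiable_on I (\<lambda>r. tan (r/2)) n"
    then have "higher_differentiable_on I (\<lambda>r. (1 + tan (r/2) * tan (r/2)) * (1/2)) n"
      by (intro hd)
    then show "higher_differentiable_on I (\<lambda>r. (1 + (tan (r/2))\<^sup>2) / 2) n"
      by (simp add: power2_eq_square)
  qed
  show K: "smooth_on I (\<lambda>r. cot (r/2))"
  proof (rule smooth_on_bootstrap[OF assms(1) cot_half_deriv[OF I]])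
    fix n assume "higher_differentiable_on I (\<lambda>r. cot (r/2)) n"
    then have "higher_differentiable_on I (\<lambda>r. (1 + cot (r/2) * cot (r/2)) * (- 1/2)) n"
      by (intro hd)
    moreover have "(\<lambda>r::real. (1 + cot (r/2) * cot (r/2)) * (- 1/2)) = (\<lambda>r. - (1 + (cot (r/2))\<^sup>2) / 2)"
      by (simp add: power2_eq_square fun_eq_iff field_simps)
    ultimately show "higher_differentiable_on I (\<lambda>r. - (1 + (cot (r/2))\<^sup>2) / 2) n" by simp
  qed
  have "smooth_on I (\<lambda>r. (tan (r/2) + cot (r/2)) * (1/2))"
    by (intro smooth_on_intros assms T K)
  then show "smooth_on I (\<lambda>r. ln (tan (r/2)))"
    by (intro smooth_on_bootstrap[OF assms(1) ln_tan_half_deriv[OF I]]) (simp_all add: smooth_on_def)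
  show "smooth_on I (\<lambda>r. ln (1 + (tan (r/2))\<^sup>2))"
    using T by (intro smooth_on_bootstrap[OF assms(1) ln_sec_half_deriv[OF I]]) (simp_all add: smooth_on_def)
qed

lemma smooth_on_rho_family:
  assumes "open I" and "I \<subseteq> {0<..<pi}"
  shows "smooth_on I (rho_family C\<^sub>0 C\<^sub>1 C\<^sub>2 C\<^sub>3 C\<^sub>4)"
proof -
  let ?U = "\<lambda>r. (C\<^sub>1 - C\<^sub>2 + C\<^sub>3) * cot (r/2) + (2 * C\<^sub>1 * ln (tan (r/2)) + C\<^sub>4) * tan (r/2)
     - (C\<^sub>1 * tan (r/2) + C\<^sub>2 * cot (r/2)) * ln (1 + (tan (r/2))\<^sup>2) - C\<^sub>0"
  have "smooth_on I (rho_family C\<^sub>0 C\<^sub>1 C\<^sub>2 C\<^sub>3 C\<^sub>4) \<longleftrightarrow> smooth_on I ?U"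
    by (rule smooth_on_cong[OF assms(1) rho_family_half_angle]) (use assms(2) in blast)
  moreover have "smooth_on I ?U"
    by (intro smooth_on_intros smooth_on_half_angle assms)
  ultimately show ?thesis by simp
qed

text \<open>
  Write \<open>T = tan (r/2)\<close>.  The derivatives of \<open>T\<close>, \<open>1 / T\<close>, \<open>ln T\<close> and \<open>ln (1 + T\<^sup>2)\<close> are all
  polynomials in \<open>T\<close> and \<open>1 / T\<close>, as are \<open>cot r\<close> and \<open>1 / sin r\<close>.  The logarithms drop out
  of the result because they multiply \<open>T\<close> and \<open>1 / T\<close>, which lie in the kernel of \<open>L\<close>.
\<close>

lemma rho_family_derivs:
  obtains U' U'' where
    "\<And>r. r \<in> {0<..<pi} \<Longrightarrow> (rho_family C\<^sub>0 C\<^sub>1 C\<^sub>2 C\<^sub>3 C\<^sub>4 has_real_derivative U' r) (at r)"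
    "\<And>r. r \<in> {0<..<pi} \<Longrightarrow> (U' has_real_derivative U'' r) (at r)"
    "\<And>r. r \<in> {0<..<pi} \<Longrightarrow> radial_op r (rho_family C\<^sub>0 C\<^sub>1 C\<^sub>2 C\<^sub>3 C\<^sub>4 r + C\<^sub>0) (U' r) (U'' r)
        = C\<^sub>1 * cot (r/2) + C\<^sub>2 * tan (r/2)"
proof -
  define T K l m :: "real \<Rightarrow> real" where
    "T = (\<lambda>r. tan (r/2))" and "K = (\<lambda>r. cot (r/2))" and "l = (\<lambda>r. ln (tan (r/2)))"
    and "m = (\<lambda>r. ln (1 + (tan (r/2))\<^sup>2))"
  define U' where "U' = (\<lambda>r. - (C\<^sub>1 - C\<^sub>2 + C\<^sub>3) * (1 + K r ^ 2) / 2 + C\<^sub>1 - C\<^sub>2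
      + (2 * C\<^sub>1 * l r + C\<^sub>4) * (1 + T r ^ 2) / 2
      - (C\<^sub>1 * (1 + T r ^ 2) - C\<^sub>2 * (1 + K r ^ 2)) * m r / 2)"
  define U'' where "U'' = (\<lambda>r. (C\<^sub>1 - C\<^sub>2 + C\<^sub>3) * (K r * (1 + K r ^ 2)) / 2
      + C\<^sub>1 * (T r + K r) * (1 + T r ^ 2) / 2 + (2 * C\<^sub>1 * l r + C\<^sub>4) * (T r * (1 + T r ^ 2)) / 2
      - (C\<^sub>1 * (T r * (1 + T r ^ 2)) + C\<^sub>2 * (K r * (1 + K r ^ 2))) * m r / 2
      - (C\<^sub>1 * (1 + T r ^ 2) - C\<^sub>2 * (1 + K r ^ 2)) * T r / 2)"
  have D: "(T has_real_derivative (1 + T r ^ 2) / 2) (at r)"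
    "(K has_real_derivative - (1 + K r ^ 2) / 2) (at r)"
    "(l has_real_derivative (T r + K r) / 2) (at r)" "(m has_real_derivative T r) (at r)"
    and TK: "K r = 1 / T r" "T r > 0" if "r \<in> {0<..<pi}" for r
    unfolding T_def K_def l_def m_def
    using tan_half_deriv[OF that] cot_half_deriv[OF that] ln_tan_half_deriv[OF that]
      ln_sec_half_deriv[OF that] cot_half[OF that] tan_half_pos[OF that] by simp_all
  have U: "rho_family C\<^sub>0 C\<^sub>1 C\<^sub>2 C\<^sub>3 C\<^sub>4 r = (C\<^sub>1 - C\<^sub>2 + C\<^sub>3) * K r + (2 * C\<^sub>1 * l r + C\<^sub>4) * T r
     - (C\<^sub>1 * T r + C\<^sub>2 * K r) * m r - C\<^sub>0" if "r \<in> {0<..<pi}" for r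
    using rho_family_half_angle[OF that] by (simp add: T_def K_def l_def m_def)
  have half: "tan (r/2) = T r" "cot (r/2) = K r" for r by (simp_all add: T_def K_def)
  show thesis
  proof
    fix r :: real assume r: "r \<in> {0<..<pi}"
    have "((\<lambda>r. (C\<^sub>1 - C\<^sub>2 + C\<^sub>3) * K r + (2 * C\<^sub>1 * l r + C\<^sub>4) * T r
      - (C\<^sub>1 * T r + C\<^sub>2 * K r) * m r - C\<^sub>0) has_real_derivative U' r) (at r)"
      using TK[OF r] unfolding U'_def
      by (auto intro!: derivative_eq_intros D[OF r]) (auto simp: field_simps power2_eq_square)
    then show "(rho_family C\<^sub>0 C\<^sub>1 C\<^sub>2 C\<^sub>3 C\<^sub>4 has_real_derivative U' r) (at r)"
      using has_field_derivative_transform_within_open[OF _ open_greaterThanLessThan r] U by simp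
    show "(U' has_real_derivative U'' r) (at r)"
      using TK[OF r] unfolding U'_def U''_def
      by (auto intro!: derivative_eq_intros D[OF r]) (auto simp: field_simps power2_eq_square)
    show "radial_op r (rho_family C\<^sub>0 C\<^sub>1 C\<^sub>2 C\<^sub>3 C\<^sub>4 r + C\<^sub>0) (U' r) (U'' r)
        = C\<^sub>1 * cot (r/2) + C\<^sub>2 * tan (r/2)"
      using TK(2)[OF r] unfolding radial_op_half_angle[OF r] U[OF r] U'_def U''_def
        half TK(1)[OF r]
      by (simp add: divide_simps) (simp add: algebra_simps power2_eq_square)
  qed
qed

section \<open>Biharmonic rotationally symmetric maps from the sphere\<close>

text \<open>
  Both fields are given by the same operator \<open>L\<close>: here \<open>w'(t) / 2 = t + C\<^sub>0\<close> and \<open>w'' / 2 = 1\<close>.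
\<close>

lemma sphere_rot_map_fields:
  fixes C\<^sub>0 C :: real
  assumes I: "open I" "I \<subseteq> {0<..<pi}"
    and J: "open J" "\<And>t. t \<in> J \<Longrightarrow> lambda_sq C\<^sub>0 C t > 0"
    and \<rho>: "smooth_on I \<rho>" "\<rho> ` I \<subseteq> J"
  obtains \<rho>' \<rho>'' F F' F'' where
    "\<And>r. r \<in> I \<Longrightarrow> (\<rho> has_real_derivative \<rho>' r) (at r)"
    "\<And>r. r \<in> I \<Longrightarrow> (\<rho>' has_real_derivative \<rho>'' r) (at r)"
    "\<And>r. r \<in> I \<Longrightarrow> F r = radial_op r (\<rho> r + C\<^sub>0) (\<rho>' r) (\<rho>'' r)"
    "\<And>r. r \<in> I \<Longrightarrow> (F has_real_derivative F' r) (at r)"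
    "\<And>r. r \<in> I \<Longrightarrow> (F' has_real_derivative F'' r) (at r)"
    "\<And>x. x $ 1 \<in> I \<Longrightarrow>
      tension_field sphere_metric (target_metric C\<^sub>0 C) (rot_map \<rho>) x = vector [F (x $ 1), 0]"
    "\<And>x. x $ 1 \<in> I \<Longrightarrow> bitension_field sphere_metric (target_metric C\<^sub>0 C) (rot_map \<rho>) x
        = vector [radial_op (x $ 1) (F (x $ 1)) (F' (x $ 1)) (F'' (x $ 1)), 0]"
proof -
  obtain \<rho>' where \<rho>': "smooth_on I \<rho>'" "\<And>r. r \<in> I \<Longrightarrow> (\<rho> has_real_derivative \<rho>' r) (at r)"
    using smooth_on_derivative[OF \<rho>(1)] by blast
  obtain \<rho>'' where \<rho>'': "smooth_on I \<rho>''" "\<And>r. r \<in> I \<Longrightarrow> (\<rho>' has_real_derivative \<rho>'' r) (at r)"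
    using smooth_on_derivative[OF \<rho>'(1)] by blast
  define F where "F r = radial_op r (\<rho> r + C\<^sub>0) (\<rho>' r) (\<rho>'' r)" for r
  have sin: "sin r > 0" if "r \<in> I" for r using that I by (intro sin_gt_zero) auto
  let ?F = "\<lambda>r. \<rho>'' r + (cot (r/2) - tan (r/2)) * (1/2) * \<rho>' r
      - (tan (r/2) + cot (r/2)) * (tan (r/2) + cot (r/2)) * (1/4) * (\<rho> r + C\<^sub>0)"
  \<comment> \<open>half-angle form of the coefficients, from which smoothness can be read off\<close>
  have F_eq: "F r = ?F r" if "r \<in> I" for r
  proof -
    have r: "r \<in> {0<..<pi}" using that I by blast
    show ?thesis
      unfolding F_def radial_op_half_angle[OF r] cot_half[OF r] using tan_half_pos[OF r]
      by (simp add: field_simps power2_eq_square)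
  qed
  have "smooth_on I F \<longleftrightarrow> smooth_on I ?F"
    by (rule smooth_on_cong[OF I(1) F_eq])
  moreover have "smooth_on I ?F"
    by (intro smooth_on_intros smooth_on_half_angle I \<rho> \<rho>' \<rho>'')
  ultimately have "smooth_on I F" by simp
  then obtain F' where F': "smooth_on I F'" "\<And>r. r \<in> I \<Longrightarrow> (F has_real_derivative F' r) (at r)"
    using smooth_on_derivative by blast
  obtain F'' where F'': "\<And>r. r \<in> I \<Longrightarrow> (F' has_real_derivative F'' r) (at r)"
    using smooth_on_derivative[OF F'(1)] by blast
  interpret rotational_map I J "\<lambda>r. (sin r)\<^sup>2" "\<lambda>r. 2 * sin r * cos r" "lambda_sq C\<^sub>0 C"
    "\<lambda>t. 2 * t + 2 * C\<^sub>0" "\<lambda>_. 2" \<rho> \<rho>'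
  proof
    fix r assume "r \<in> I"
    then show "(sin r)\<^sup>2 \<noteq> 0" "\<rho> r \<in> J" using sin \<rho> by fastforce+
    show "((\<lambda>r. (sin r)\<^sup>2) has_real_derivative 2 * sin r * cos r) (at r)"
      by (auto intro!: derivative_eq_intros)
  next
    fix t assume "t \<in> J"
    then show "lambda_sq C\<^sub>0 C t \<noteq> 0" using J(2) by fastforce
    show "(lambda_sq C\<^sub>0 C has_real_derivative 2 * t + 2 * C\<^sub>0) (at t)"
      unfolding lambda_sq_def by (auto intro!: derivative_eq_intros)
    show "((\<lambda>t. 2 * t + 2 * C\<^sub>0) has_real_derivative 2) (at t)"
      by (auto intro!: derivative_eq_intros)
  qed (use I J \<rho>' in auto)
  have coeff: "2 * sin r * cos r / (2 * (sin r)\<^sup>2) = cot r"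
    "(2 * a + 2 * C\<^sub>0) / (2 * (sin r)\<^sup>2) = (a + C\<^sub>0) / (sin r)\<^sup>2"
    "2 * a / (2 * (sin r)\<^sup>2) = a / (sin r)\<^sup>2" if "r \<in> I" for r a
    using sin[OF that] by (simp_all add: cot_def divide_simps power2_eq_square)
  have \<tau>: "tension_field g h \<phi> x = vector [F (x $ 1), 0]" if "x $ 1 \<in> I" for x
    unfolding tension_field_rot_map[OF that \<rho>''(2)[OF that]] coeff[OF that] F_def radial_op_def ..
  show thesis
  proof (rule that[of \<rho>' \<rho>'' F F' F''])
    show "tension_field sphere_metric (target_metric C\<^sub>0 C) \<phi> x = vector [F (x $ 1), 0]"
      if "x $ 1 \<in> I" for x
      using \<tau>[OF that] by (simp add: sphere_metric_def target_metric_def)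
    show "bitension_field sphere_metric (target_metric C\<^sub>0 C) \<phi> x
        = vector [radial_op (x $ 1) (F (x $ 1)) (F' (x $ 1)) (F'' (x $ 1)), 0]"
      if "x $ 1 \<in> I" for x
    proof -
      have "bitension_field g h \<phi> x = vector [F'' (x $ 1)
        + 2 * sin (x $ 1) * cos (x $ 1) / (2 * (sin (x $ 1))\<^sup>2) * F' (x $ 1)
        - 2 * F (x $ 1) / (2 * (sin (x $ 1))\<^sup>2), 0]"
        by (rule bitension_field_rot_map[OF that \<tau> F'(2) F''[OF that]])
      then show ?thesis
        unfolding coeff[OF that] by (simp add: radial_op_def sphere_metric_def target_metric_def)
    qed
  qed (use \<rho>' \<rho>'' F' F'' in \<open>auto simp: F_def\<close>)
qed

theorem theorem4p5:
  fixes C\<^sub>0 C :: real and I J :: "real set"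
  assumes "open I" and "is_interval I" and "I \<noteq> {}" and "I \<subseteq> {0<..<pi}"
    and "open J" and "is_interval J" and "\<And>\<rho>. \<rho> \<in> J \<Longrightarrow> lambda_sq C\<^sub>0 C \<rho> > 0"
  shows "(\<forall>\<rho> :: real \<Rightarrow> real. smooth_on I \<rho> \<longrightarrow> \<rho> ` I \<subseteq> J \<longrightarrow>
            (biharmonic_map (polar_domain I) sphere_metric (target_metric C\<^sub>0 C) (rot_map \<rho>)
             \<longleftrightarrow> (\<exists>C\<^sub>1 C\<^sub>2 C\<^sub>3 C\<^sub>4. \<forall>r\<in>I. \<rho> r = rho_family C\<^sub>0 C\<^sub>1 C\<^sub>2 C\<^sub>3 C\<^sub>4 r)))
       \<and> (\<forall>(\<rho> :: real \<Rightarrow> real) C\<^sub>1 C\<^sub>2 C\<^sub>3 C\<^sub>4. \<rho> ` I \<subseteq> J \<longrightarrow>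
            (\<forall>r\<in>I. \<rho> r = rho_family C\<^sub>0 C\<^sub>1 C\<^sub>2 C\<^sub>3 C\<^sub>4 r) \<longrightarrow> C\<^sub>1\<^sup>2 + C\<^sub>2\<^sup>2 \<noteq> 0 \<longrightarrow>
            proper_biharmonic_map (polar_domain I) sphere_metric (target_metric C\<^sub>0 C) (rot_map \<rho>))"
proof -
  let ?g = sphere_metric and ?h = "target_metric C\<^sub>0 C"
  have I: "r \<in> {0<..<pi}" if "r \<in> I" for r using that assms(4) by blast
  have convex: "convex I" using assms(2) by (simp add: is_interval_convex)
  have pt: "\<exists>x :: real ^ 2. x \<in> polar_domain I \<and> x $ 1 = r" if "r \<in> I" for r
    using that by (intro exI[of _ "vector [r, 0]"]) (simp add: polar_domain_def)
  have family_if: "\<exists>C\<^sub>1 C\<^sub>2 C\<^sub>3 C\<^sub>4. \<forall>r\<in>I. \<rho> r = rho_family C\<^sub>0 C\<^sub>1 C\<^sub>2 C\<^sub>3 C\<^sub>4 r"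
    if smooth: "smooth_on I \<rho>" and J: "\<rho> ` I \<subseteq> J"
      and bi: "biharmonic_map (polar_domain I) ?g ?h (rot_map \<rho>)" for \<rho>
  proof -
    obtain \<rho>' \<rho>'' F F' F'' where \<rho>: "\<And>r. r \<in> I \<Longrightarrow> (\<rho> has_real_derivative \<rho>' r) (at r)"
      "\<And>r. r \<in> I \<Longrightarrow> (\<rho>' has_real_derivative \<rho>'' r) (at r)"
      and F: "\<And>r. r \<in> I \<Longrightarrow> F r = radial_op r (\<rho> r + C\<^sub>0) (\<rho>' r) (\<rho>'' r)"
      and DF: "\<And>r. r \<in> I \<Longrightarrow> (F has_real_derivative F' r) (at r)"
        "\<And>r. r \<in> I \<Longrightarrow> (F' has_real_derivative F'' r) (at r)"
      and "\<And>x. x $ 1 \<in> I \<Longrightarrow> tension_field ?g ?h (rot_map \<rho>) x = vector [F (x $ 1), 0]"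
      and \<tau>\<^sub>2: "\<And>x. x $ 1 \<in> I \<Longrightarrow> bitension_field ?g ?h (rot_map \<rho>) x
        = vector [radial_op (x $ 1) (F (x $ 1)) (F' (x $ 1)) (F'' (x $ 1)), 0]"
      by (rule sphere_rot_map_fields[OF assms(1,4,5,7) smooth J]) (assumption, rule that)
    have LF: "radial_op r (F r) (F' r) (F'' r) = 0" if r: "r \<in> I" for r
    proof -
      obtain x :: "real ^ 2" where "x \<in> polar_domain I" "x $ 1 = r" using pt[OF r] by blast
      then show ?thesis
        using bi \<tau>\<^sub>2[of x] r by (simp add: biharmonic_map_def vec_eq_iff forall_2)
    qed
    obtain a b where ab: "\<And>r. r \<in> I \<Longrightarrow> F r = a * tan (r/2) + b * cot (r/2)"
      by (rule radial_op_kernel[OF convex assms(4) DF LF]) (assumption+, rule that)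
    \<comment> \<open>particular solution; the third constant makes the coefficient of \<open>cot (r/2)\<close> vanish\<close>
    let ?U = "rho_family C\<^sub>0 b a (a - b) 0"
    obtain U' U'' where U: "\<And>r. r \<in> {0<..<pi} \<Longrightarrow> (?U has_real_derivative U' r) (at r)"
      "\<And>r. r \<in> {0<..<pi} \<Longrightarrow> (U' has_real_derivative U'' r) (at r)"
      "\<And>r. r \<in> {0<..<pi} \<Longrightarrow> radial_op r (?U r + C\<^sub>0) (U' r) (U'' r) = b * cot (r/2) + a * tan (r/2)"
      by (rule rho_family_derivs) (rule that)
    have L0: "radial_op r (\<rho> r - ?U r) (\<rho>' r - U' r) (\<rho>'' r - U'' r) = 0" if r: "r \<in> I" for r
    proof -
      have "radial_op r (\<rho> r - ?U r) (\<rho>' r - U' r) (\<rho>'' r - U'' r)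
        = radial_op r (\<rho> r + C\<^sub>0) (\<rho>' r) (\<rho>'' r) - radial_op r (?U r + C\<^sub>0) (U' r) (U'' r)"
        by (simp add: radial_op_def algebra_simps diff_divide_distrib add_divide_distrib)
      then show ?thesis using F[OF r] ab[OF r] U(3)[OF I[OF r]] by simp
    qed
    obtain c d where cd: "\<And>r. r \<in> I \<Longrightarrow> \<rho> r - ?U r = c * tan (r/2) + d * cot (r/2)"
      by (rule radial_op_kernel[OF convex assms(4) DERIV_diff[OF \<rho>(1) U(1)[OF I]]
          DERIV_diff[OF \<rho>(2) U(2)[OF I]] L0]) (assumption+, rule that)
    have "\<rho> r = rho_family C\<^sub>0 b a (a - b + d) c r" if r: "r \<in> I" for r
      using cd[OF r] by (simp add: rho_family_half_angle[OF I[OF r]] algebra_simps)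
    then show ?thesis by blast
  qed
  have family: "biharmonic_map (polar_domain I) ?g ?h (rot_map \<rho>)"
    "C\<^sub>1\<^sup>2 + C\<^sub>2\<^sup>2 \<noteq> 0 \<Longrightarrow> \<not> harmonic_map (polar_domain I) ?g ?h (rot_map \<rho>)"
    if J: "\<rho> ` I \<subseteq> J" and fam: "\<And>r. r \<in> I \<Longrightarrow> \<rho> r = rho_family C\<^sub>0 C\<^sub>1 C\<^sub>2 C\<^sub>3 C\<^sub>4 r"
    for \<rho> C\<^sub>1 C\<^sub>2 C\<^sub>3 C\<^sub>4
  proof -
    let ?G = "\<lambda>r. C\<^sub>1 * cot (r/2) + C\<^sub>2 * tan (r/2)"
    have "smooth_on I \<rho> \<longleftrightarrow> smooth_on I (rho_family C\<^sub>0 C\<^sub>1 C\<^sub>2 C\<^sub>3 C\<^sub>4)"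
      by (rule smooth_on_cong[OF assms(1) fam])
    then have smooth: "smooth_on I \<rho>"
      using smooth_on_rho_family[OF assms(1,4)] by simp
    obtain \<rho>' \<rho>'' F F' F'' where \<rho>: "\<And>r. r \<in> I \<Longrightarrow> (\<rho> has_real_derivative \<rho>' r) (at r)"
      "\<And>r. r \<in> I \<Longrightarrow> (\<rho>' has_real_derivative \<rho>'' r) (at r)"
      and F: "\<And>r. r \<in> I \<Longrightarrow> F r = radial_op r (\<rho> r + C\<^sub>0) (\<rho>' r) (\<rho>'' r)"
      and DF: "\<And>r. r \<in> I \<Longrightarrow> (F has_real_derivative F' r) (at r)"
        "\<And>r. r \<in> I \<Longrightarrow> (F' has_real_derivative F'' r) (at r)"
      and \<tau>: "\<And>x. x $ 1 \<in> I \<Longrightarrow> tension_field ?g ?h (rot_map \<rho>) x = vector [F (x $ 1), 0]"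
      and \<tau>\<^sub>2: "\<And>x. x $ 1 \<in> I \<Longrightarrow> bitension_field ?g ?h (rot_map \<rho>) x
        = vector [radial_op (x $ 1) (F (x $ 1)) (F' (x $ 1)) (F'' (x $ 1)), 0]"
      by (rule sphere_rot_map_fields[OF assms(1,4,5,7) smooth J]) (assumption, rule that)
    obtain U' U'' where
      U: "\<And>r. r \<in> {0<..<pi} \<Longrightarrow> (rho_family C\<^sub>0 C\<^sub>1 C\<^sub>2 C\<^sub>3 C\<^sub>4 has_real_derivative U' r) (at r)"
      "\<And>r. r \<in> {0<..<pi} \<Longrightarrow> (U' has_real_derivative U'' r) (at r)"
      "\<And>r. r \<in> {0<..<pi} \<Longrightarrow> radial_op r (rho_family C\<^sub>0 C\<^sub>1 C\<^sub>2 C\<^sub>3 C\<^sub>4 r + C\<^sub>0) (U' r) (U'' r) = ?G r"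
      by (rule rho_family_derivs) (rule that)
    have \<rho>'U: "\<rho>' r = U' r" if "r \<in> I" for r
      by (rule derivative_eq_on_open[OF assms(1) fam \<rho>(1) U(1)[OF I] that])
    have \<rho>''U: "\<rho>'' r = U'' r" if "r \<in> I" for r
      by (rule derivative_eq_on_open[OF assms(1) \<rho>'U \<rho>(2) U(2)[OF I] that])
    have FG: "F r = ?G r" if "r \<in> I" for r
      using F[OF that] U(3)[OF I[OF that]] fam[OF that] \<rho>'U[OF that] \<rho>''U[OF that] by simp
    have "radial_op r (F r) (F' r) (F'' r) = 0" if "r \<in> I" for r
      by (rule trans[OF radial_op_cong[OF assms(1) FG DF half_angle_combination_deriv[OF I]
            half_angle_combination_deriv2[OF I] that] radial_op_half_angle_combination[OF I[OF that]]])
    then show "biharmonic_map (polar_domain I) ?g ?h (rot_map \<rho>)"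
      using \<tau>\<^sub>2 smooth_on_rot_map[OF assms(1) smooth]
      by (simp add: biharmonic_map_def polar_domain_def vec_eq_iff forall_2)
    assume ne: "C\<^sub>1\<^sup>2 + C\<^sub>2\<^sup>2 \<noteq> 0"
    show "\<not> harmonic_map (polar_domain I) ?g ?h (rot_map \<rho>)"
    proof
      assume harm: "harmonic_map (polar_domain I) ?g ?h (rot_map \<rho>)"
      have G0: "?G r = 0" if r: "r \<in> I" for r
      proof -
        obtain x :: "real ^ 2" where "x \<in> polar_domain I" "x $ 1 = r" using pt[OF r] by blast
        then show ?thesis
          using harm \<tau>[of x] r FG[OF r] by (simp add: harmonic_map_def vec_eq_iff forall_2)
      qed
      \<comment> \<open>the function and its derivative at one point give two independent linear equations\<close>
      obtain r where r: "r \<in> I" using assms(3) by blast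
      define T where "T = tan (r/2)"
      have T: "T > 0" "cot (r/2) = 1 / T" using tan_half_pos cot_half I[OF r] by (auto simp: T_def)
      have "- C\<^sub>1 * (1 + (cot (r/2))\<^sup>2) / 2 + C\<^sub>2 * (1 + (tan (r/2))\<^sup>2) / 2 = 0"
        by (rule derivative_eq_on_open[OF assms(1) G0 half_angle_combination_deriv[OF I]
              DERIV_const r])
      then have 1: "(C\<^sub>2 * T\<^sup>2) * (1 + T\<^sup>2) = C\<^sub>1 * (1 + T\<^sup>2)"
        using T unfolding T_def[symmetric] by (simp add: field_simps power2_eq_square)
      have 2: "C\<^sub>2 * T\<^sup>2 = - C\<^sub>1"
        using G0[OF r] T unfolding T_def[symmetric] by (simp add: field_simps power2_eq_square)
      have "1 + T\<^sup>2 > 0" by (simp add: add_pos_nonneg)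
      then have "C\<^sub>1 = 0" using 1 unfolding 2 by simp
      then show False using 2 T ne by simp
    qed
  qed
  show ?thesis
  proof (intro conjI allI impI)
    fix \<rho> :: "real \<Rightarrow> real"
    assume \<rho>: "smooth_on I \<rho>" "\<rho> ` I \<subseteq> J"
    show "biharmonic_map (polar_domain I) ?g ?h (rot_map \<rho>)
        \<longleftrightarrow> (\<exists>C\<^sub>1 C\<^sub>2 C\<^sub>3 C\<^sub>4. \<forall>r\<in>I. \<rho> r = rho_family C\<^sub>0 C\<^sub>1 C\<^sub>2 C\<^sub>3 C\<^sub>4 r)"
      using family_if[OF \<rho>] family(1)[OF \<rho>(2)] by metis
  next
    fix \<rho> :: "real \<Rightarrow> real" and C\<^sub>1 C\<^sub>2 C\<^sub>3 C\<^sub>4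
    assume \<rho>: "\<rho> ` I \<subseteq> J" "\<forall>r\<in>I. \<rho> r = rho_family C\<^sub>0 C\<^sub>1 C\<^sub>2 C\<^sub>3 C\<^sub>4 r"
      and "C\<^sub>1\<^sup>2 + C\<^sub>2\<^sup>2 \<noteq> 0"
    then show "proper_biharmonic_map (polar_domain I) ?g ?h (rot_map \<rho>)"
      using family[of \<rho> C\<^sub>1 C\<^sub>2 C\<^sub>3 C\<^sub>4] by (simp add: proper_biharmonic_map_def)
  qed
qed

end
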